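(* There exists a separate continuous function $f\colon\mathbb{Q}\times\mathbb{Q}\to[0,1]$ which is not feebly continuous.
   Context: $\mathbb{Q}$ and $[0,1]$ carry their usual topologies inherited from $\mathbb{R}$, and $\mathbb{Q}\times\mathbb{Q}$ carries the product topology. A function $f\colon X\times Y\to Z$ between topological spaces is called separate continuous if, for each $(x,y)\in X\times Y$, the functions $f(x,\cdot)\colon Y\to Z$ and $f(\cdot,y)\colon X\to Z$ are continuous. A function $f\colon P\to Z$ between topological spaces is called feebly continuous (also: somewhat continuous) if for every open set $U\subseteq Z$ with $f^{-1}[U]\neq\emptyset$, the preimage $f^{-1}[U]$ has non-empty interior in $P$ (equivalently, $f$, regarded as a surjection onto its image $f[P]$ with the subspace topology, has the property that the preimage of every non-empty open subset of $f[P]$ has non-empty interior). *)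

theory Defs
  imports "HOL-Analysis.Analysis"
begin

definition separately_continuous_map ::
  "'a topology \<Rightarrow> 'b topology \<Rightarrow> 'c topology \<Rightarrow> ('a \<times> 'b \<Rightarrow> 'c) \<Rightarrow> bool" where
  "separately_continuous_map X Y Z f \<longleftrightarrow>
     (\<forall>x \<in> topspace X. \<forall>y \<in> topspace Y.
        continuous_map Y Z (\<lambda>v. f (x, v)) \<and> continuous_map X Z (\<lambda>u. f (u, y)))"

(* Unlike continuous_map, this does not include the condition that f maps topspace P
   into topspace Z; otherwise its negation could hold merely because that fails. *)
definition feebly_continuous_map :: "'a topology \<Rightarrow> 'b topology \<Rightarrow> ('a \<Rightarrow> 'b) \<Rightarrow> bool" where
  "feebly_continuous_map P Z f \<longleftrightarrow>
     (\<forall>U. openin Z U \<and> {p \<in> topspace P. f p \<in> U} \<noteq> {} \<longrightarrow>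
        P interior_of {p \<in> topspace P. f p \<in> U} \<noteq> {})"

(* There is no topology on the type rat in the libraries, so the rationals are
   taken as a subspace of the reals. *)
abbreviation rat_topology :: "real topology" where
  "rat_topology \<equiv> top_of_set \<rat>"

abbreviation unit_interval_topology :: "real topology" where
  "unit_interval_topology \<equiv> top_of_set {0..1}"

end

(* Enumerate the rationals as q 0, q 1, ... and define f one cross at a time: the function phi n is
   used both on the vertical and on the horizontal line through q n. When phi n is constructed, only
   its values at q i for i < n are prescribed (by symmetry, they are phi i (q n)), so one can take phi n
   to be a finite sum of tent functions centred at these points, which is continuous on the whole line.
   The tents are so narrow that phi n has a zero within 1/n of every q i with i < n. Hence the
   zeros of f are dense, although phi 0 = 1. *)

theory Submission
  imports Defs
begin

text \<open>Limit points give infinitely many rationals in every ball, hence ones of arbitrarily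
  large index.\<close>

lemma islimpt_Rats: "(x::real) islimpt \<rat>"
  unfolding islimpt_approachable
proof (intro allI impI)
  fix e :: real
  assume "e > 0"
  then obtain r where "r \<in> \<rat>" "x < r" "r < x + e"
    using Rats_dense_in_real[of x "x + e"] by auto
  then show "\<exists>x'\<in>\<rat>. x' \<noteq> x \<and> dist x' x < e"
    by (intro bexI[of _ r]) (auto simp: dist_real_def)
qed

definition rat_enum :: "nat \<Rightarrow> real" where
  "rat_enum = from_nat_into \<rat>"

definition rat_index :: "real \<Rightarrow> nat" where
  "rat_index = to_nat_on \<rat>"

lemma infinite_Rats_real: "infinite (\<rat> :: real set)"
  using islimpt_Rats islimpt_finite by blast

lemma rat_enum_Rats [simp]: "rat_enum n \<in> \<rat>"
  unfolding rat_enum_def by (rule from_nat_into) (use Rats_0 in blast)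

lemma rat_index_enum [simp]: "rat_index (rat_enum n) = n"
  by (simp add: rat_enum_def rat_index_def countable_rat infinite_Rats_real)

lemma rat_enum_index [simp]: "x \<in> \<rat> \<Longrightarrow> rat_enum (rat_index x) = x"
  by (simp add: rat_enum_def rat_index_def countable_rat)

lemma rat_enum_eq_iff [simp]: "rat_enum m = rat_enum n \<longleftrightarrow> m = n"
  by (metis rat_index_enum)

text \<open>The half distances will keep the tents of radius \<open>gap n\<close> apart. The element
  \<open>1 / (real n + 1)\<close> makes the radii tend to 0 and keeps the set nonempty when n is 0
  or 1.\<close>

definition gap_set :: "nat \<Rightarrow> real set" where
  "gap_set n = insert (1 / (real n + 1))
     ((\<lambda>(i, j). \<bar>rat_enum i - rat_enum j\<bar> / 2) ` {(i, j). i < n \<and> j < n \<and> i \<noteq> j})"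

definition gap :: "nat \<Rightarrow> real" where
  "gap n = Min (gap_set n)"

lemma finite_gap_set: "finite (gap_set n)"
proof -
  have "{(i, j). i < n \<and> j < n \<and> i \<noteq> j} \<subseteq> {..<n} \<times> {..<n}"
    by auto
  then show ?thesis
    unfolding gap_set_def by (meson finite.insertI finite_SigmaI finite_imageI finite_lessThan finite_subset)
qed

lemma gap_in_gap_set: "gap n \<in> gap_set n"
  unfolding gap_def by (rule Min_in[OF finite_gap_set]) (simp add: gap_set_def)

lemma gap_pos: "gap n > 0"
proof -
  have "\<forall>d\<in>gap_set n. d > 0"
    by (auto simp: gap_set_def)
  then show ?thesis
    using gap_in_gap_set by blast
qed

text \<open>Ensures that the zeros found at distance \<open>gap n\<close> from a centre are rational
  points.\<close>

lemma gap_Rats: "gap n \<in> \<rat>"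
proof -
  have "\<bar>rat_enum i - rat_enum j\<bar> / 2 \<in> \<rat>" for i j
    by (intro Rats_divide) (auto simp: abs_if)
  moreover have "1 / (real n + 1) \<in> \<rat>"
    by (intro Rats_divide Rats_add) auto
  ultimately show ?thesis
    using gap_in_gap_set[of n] unfolding gap_set_def by (smt (verit) case_prod_beta imageE insertE)
qed

lemma gap_le: "gap n \<le> 1 / (real n + 1)"
  unfolding gap_def by (rule Min_le[OF finite_gap_set]) (simp add: gap_set_def)

lemma gap_separates:
  assumes "i < n" "j < n" "i \<noteq> j"
  shows "2 * gap n \<le> \<bar>rat_enum i - rat_enum j\<bar>"
proof -
  have "gap n \<le> \<bar>rat_enum i - rat_enum j\<bar> / 2"
    unfolding gap_def
    by (rule Min_le[OF finite_gap_set]) (use assms in \<open>auto simp: gap_set_def image_iff\<close>)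
  then show ?thesis by simp
qed

definition tent :: "nat \<Rightarrow> nat \<Rightarrow> real \<Rightarrow> real" where
  "tent n i x = max 0 (1 - \<bar>x - rat_enum i\<bar> / gap n)"

lemma tent_nonneg: "tent n i x \<ge> 0"
  by (simp add: tent_def)

lemma tent_center: "tent n i (rat_enum i) = 1"
  by (simp add: tent_def)

lemma tent_eq_0: "gap n \<le> \<bar>x - rat_enum i\<bar> \<Longrightarrow> tent n i x = 0"
  using gap_pos[of n] by (simp add: tent_def field_simps)

text \<open>The cap \<open>min 1\<close> gives the upper bound at once and leaves the prescribed
  values intact, since these are at most 1.\<close>

function line_fun :: "nat \<Rightarrow> real \<Rightarrow> real" where
  "line_fun n x =
     (if n = 0 then 1 else min 1 (\<Sum>i<n. line_fun i (rat_enum n) * tent n i x))"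
  by auto
termination by (relation "Wellfounded.measure fst") auto

declare line_fun.simps [simp del]

lemma line_fun_0: "line_fun 0 x = 1"
  by (simp add: line_fun.simps)

lemma line_fun_pos_index:
  "n > 0 \<Longrightarrow> line_fun n x = min 1 (\<Sum>i<n. line_fun i (rat_enum n) * tent n i x)"
  by (subst line_fun.simps) simp

lemma line_fun_nonneg: "line_fun n x \<ge> 0"
proof (induction n arbitrary: x rule: less_induct)
  case (less n)
  then have "(\<Sum>i<n. line_fun i (rat_enum n) * tent n i x) \<ge> 0"
    by (intro sum_nonneg mult_nonneg_nonneg tent_nonneg) auto
  then show ?case
    by (subst line_fun.simps) simp
qed

lemma line_fun_le_1: "line_fun n x \<le> 1"
  by (subst line_fun.simps) simp

lemma continuous_line_fun: "continuous_on A (line_fun n)"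
proof -
  have "continuous_on A
    (\<lambda>x. if n = 0 then 1 else min 1 (\<Sum>i<n. line_fun i (rat_enum n) * tent n i x))"
    using gap_pos[of n] by (cases "n = 0") (auto simp: tent_def intro!: continuous_intros)
  then show ?thesis
    by (subst line_fun.simps[abs_def])
qed

text \<open>Distinct centres are at least \<open>2 * gap n\<close> apart, so at
  \<open>rat_enum m\<close> only the tent with index m survives, and it has height 1 there.\<close>

lemma line_fun_at_earlier:
  assumes "m < n"
  shows "line_fun n (rat_enum m) = line_fun m (rat_enum n)"
proof -
  have "tent n i (rat_enum m) = 0" if "i < n" "i \<noteq> m" for i
    using gap_separates[of m n i] gap_pos[of n] assms that by (intro tent_eq_0) auto
  then have "(\<Sum>i<n. line_fun i (rat_enum n) * tent n i (rat_enum m))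
      = (\<Sum>i<n. if i = m then line_fun m (rat_enum n) else 0)"
    by (intro sum.cong) (auto simp: tent_center)
  then show ?thesis
    using assms line_fun_le_1[of m "rat_enum n"] by (simp add: line_fun_pos_index)
qed

lemma line_fun_sym: "line_fun n (rat_enum m) = line_fun m (rat_enum n)"
  by (metis line_fun_at_earlier linorder_neqE_nat)

text \<open>The point lies on the edge of the tent around \<open>rat_enum k\<close>; by the triangle
  inequality it is at least \<open>2 * gap n - gap n\<close> away from every other centre.\<close>

lemma line_fun_shift_eq_0:
  assumes "k < n"
  shows "line_fun n (rat_enum k + gap n) = 0"
proof -
  have "tent n i (rat_enum k + gap n) = 0" if "i < n" for i
    using gap_separates[of k n i] gap_pos[of n] assms that
    by (cases "i = k") (auto intro!: tent_eq_0)
  then show ?thesis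
    using assms by (simp add: line_fun_pos_index)
qed

definition cross_fun :: "real \<times> real \<Rightarrow> real" where
  "cross_fun p = line_fun (rat_index (fst p)) (snd p)"

lemma cross_fun_bounds: "cross_fun p \<in> {0..1}"
  by (simp add: cross_fun_def line_fun_nonneg line_fun_le_1)

lemma cross_fun_sym:
  assumes "x \<in> \<rat>" "y \<in> \<rat>"
  shows "cross_fun (x, y) = cross_fun (y, x)"
  using line_fun_sym[of "rat_index x" "rat_index y"] assms by (simp add: cross_fun_def)

lemma separately_continuous_cross_fun:
  "separately_continuous_map rat_topology rat_topology unit_interval_topology cross_fun"
  unfolding separately_continuous_map_def
proof (intro ballI conjI)
  fix x y :: real
  assume "x \<in> topspace rat_topology" "y \<in> topspace rat_topology"
  then have y: "y \<in> \<rat>" by simp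
  have *: "continuous_map rat_topology unit_interval_topology (\<lambda>v. cross_fun (x, v))" for x
    using cross_fun_bounds by (auto simp: cross_fun_def continuous_line_fun)
  then show "continuous_map rat_topology unit_interval_topology (\<lambda>v. cross_fun (x, v))" .
  show "continuous_map rat_topology unit_interval_topology (\<lambda>u. cross_fun (u, y))"
    \<comment> \<open>By symmetry the horizontal section at y agrees on the rationals with the
      vertical section at y.\<close>
    by (rule continuous_map_eq[OF *[of y]]) (use y cross_fun_sym in auto)
qed

lemma cross_fun_zero_dense:
  assumes "v \<in> \<rat>" "e > 0"
  obtains x y where "x \<in> \<rat>" "y \<in> \<rat>" "dist u x < e" "dist v y < e" "cross_fun (x, y) = 0"
proof -
  \<comment> \<open>An index n above both bounds makes v one of the centres for
    \<open>line_fun n\<close> and forces \<open>gap n < e\<close>.\<close>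
  define N where "N = max (rat_index v) (nat \<lceil>1 / e\<rceil>)"
  have "infinite (\<rat> \<inter> ball u e)"
    using islimpt_Rats[of u] \<open>e > 0\<close> by (auto simp: islimpt_eq_infinite_ball)
  moreover have "finite (rat_enum ` {..N})" by simp
  ultimately obtain x where x: "x \<in> \<rat> \<inter> ball u e" "x \<notin> rat_enum ` {..N}"
    by (meson finite_subset subsetI)
  define n where "n = rat_index x"
  have "n > N"
    using x rat_enum_index[of x] unfolding n_def by (metis IntD1 atMost_iff image_eqI not_le)
  then have "1 / e < real n + 1"
    unfolding N_def by linarith
  then have "1 / (real n + 1) < e"
    using \<open>e > 0\<close> by (simp add: field_simps)
  then have "gap n < e"
    using gap_le[of n] by linarith
  moreover have "cross_fun (x, v + gap n) = 0"
    using line_fun_shift_eq_0[of "rat_index v" n] \<open>n > N\<close> \<open>v \<in> \<rat>\<close>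
    by (simp add: cross_fun_def N_def n_def)
  ultimately show thesis
    using that[of x "v + gap n"] x gap_pos[of n] \<open>v \<in> \<rat>\<close> gap_Rats[of n]
    by (auto simp: dist_real_def Rats_add)
qed

text \<open>The set where the function is positive contains the line through
  \<open>rat_enum 0\<close>, but any open box inside it would contain one of the dense
  zeros.\<close>

lemma not_feebly_continuous_cross_fun:
  "\<not> feebly_continuous_map (prod_topology rat_topology rat_topology) unit_interval_topology cross_fun"
proof
  let ?P = "prod_topology rat_topology rat_topology :: (real \<times> real) topology"
  let ?S = "{p \<in> topspace ?P. cross_fun p \<in> {0<..1}}"
  assume feeble: "feebly_continuous_map ?P unit_interval_topology cross_fun"
  have "openin unit_interval_topology {0<..1::real}"
    unfolding openin_open by (intro exI[of _ "{0<..}"]) auto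
  moreover have "(rat_enum 0, 0) \<in> ?S"
    by (simp add: cross_fun_def line_fun_0)
  ultimately have "?P interior_of ?S \<noteq> {}"
    using feeble unfolding feebly_continuous_map_def by blast
  then obtain u v T where "openin ?P T" "(u, v) \<in> T" "T \<subseteq> ?S"
    unfolding interior_of_def by auto
  then obtain A B where "openin rat_topology A" "openin rat_topology B"
      "u \<in> A" "v \<in> B" "A \<times> B \<subseteq> ?S"
    unfolding openin_prod_topology_alt by (meson order_trans)
  obtain a where "a > 0" and a: "\<And>x. x \<in> \<rat> \<Longrightarrow> dist x u < a \<Longrightarrow> x \<in> A"
    using \<open>openin rat_topology A\<close> \<open>u \<in> A\<close> unfolding openin_euclidean_subtopology_iff by blast
  obtain b where "b > 0" and b: "\<And>y. y \<in> \<rat> \<Longrightarrow> dist y v < b \<Longrightarrow> y \<in> B"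
    using \<open>openin rat_topology B\<close> \<open>v \<in> B\<close> unfolding openin_euclidean_subtopology_iff by blast
  have "v \<in> \<rat>"
    using \<open>openin rat_topology B\<close> \<open>v \<in> B\<close> openin_imp_subset by blast
  \<comment> \<open>The density lemma has a single radius for both coordinates, hence the
    minimum.\<close>
  with \<open>a > 0\<close> \<open>b > 0\<close> obtain x y where "x \<in> \<rat>" "y \<in> \<rat>" "dist u x < min a b" "dist v y < min a b"
      "cross_fun (x, y) = 0"
    using cross_fun_zero_dense[of v "min a b" u] by auto
  then have "(x, y) \<in> A \<times> B"
    using a b by (simp add: dist_commute)
  then have "(x, y) \<in> ?S"
    using \<open>A \<times> B \<subseteq> ?S\<close> by blast
  then show False
    using \<open>cross_fun (x, y) = 0\<close> by simp
qed

theorem corollary3: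
  shows "\<exists>f :: real \<times> real \<Rightarrow> real.
    f \<in> \<rat> \<times> \<rat> \<rightarrow> {0..1} \<and>
    separately_continuous_map rat_topology rat_topology unit_interval_topology f \<and>
    \<not> feebly_continuous_map (prod_topology rat_topology rat_topology) unit_interval_topology f"
  using cross_fun_bounds separately_continuous_cross_fun not_feebly_continuous_cross_fun
  by blast

end
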